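(* Let $a$ be a real number with $0<a<1$, let $b$ be an integer with $b>1/a$, and let $f:\mathbb N\to\mathbb C$ be an arbitrary bounded function. For $t\in\mathbb R$ let $$W_{a,b}(f;t)=\sum_{k=1}^\infty f(k)a^ke^{2\pi i b^kt}.$$ Then: (i) The function $t\mapsto W_{a,b}(f;t)$ is Hölder continuous with exponent $-\log_b a$, and the same holds for the real-valued functions $|W_{a,b}(f;t)|$, $\operatorname{Re}W_{a,b}(f;t)$, and $\operatorname{Im}W_{a,b}(f;t)$. (ii) The upper box-counting dimensions of the graphs of the functions $|W_{a,b}(f;t)|$, $\operatorname{Re}W_{a,b}(f;t)$, and $\operatorname{Im}W_{a,b}(f;t)$ over the interval $[0,1]$ are at most $2+\log_b a$.
   Context: $\mathbb N=\{1,2,3,\dots\}$, and $\log_b a=\log a/\log b$. A function $g$ is Hölder continuous with exponent $\eta\in(0,1)$ if there is a constant $K>0$ such that $|g(x)-g(y)|\le K|x-y|^\eta$ for all $x,y$ in its domain (here $\mathbb R$; the functions are $1$-periodic). The graph of a real-valued function $g$ over $[0,1]$ is $\{(t,g(t))\in\mathbb R^2:t\in[0,1]\}$. For a bounded set $E\subset\mathbb R^d$ and $r>0$, let $N(E,r)$ be the minimal number of sets of diameter at most $r$ needed to cover $E$. The upper box-counting dimension of $E$ is $\overline{\dim_B}E=\limsup_{r\to0}\frac{\log N(E,r)}{\log(1/r)}$. *)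

theory Defs
  imports "HOL-Analysis.Analysis"
begin

(* The coefficients f(k) are indexed by k >= 1; the value f 0 is never used. *)
definition W :: "real \<Rightarrow> int \<Rightarrow> (nat \<Rightarrow> complex) \<Rightarrow> real \<Rightarrow> complex" where
  "W a b f t =
     (\<Sum>k. f (Suc k) * of_real a ^ Suc k *
           exp (2 * of_real pi * \<i> * of_int b ^ Suc k * of_real t))"

definition holder_continuous :: "real \<Rightarrow> (real \<Rightarrow> 'a::real_normed_vector) \<Rightarrow> bool" where
  "holder_continuous \<eta> g \<longleftrightarrow>
     0 < \<eta> \<and> \<eta> < 1 \<and> (\<exists>K>0. \<forall>x y. norm (g x - g y) \<le> K * \<bar>x - y\<bar> powr \<eta>)"

definition graph_on :: "real set \<Rightarrow> (real \<Rightarrow> real) \<Rightarrow> (real \<times> real) set" where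
  "graph_on S g = {(t, g t) | t. t \<in> S}"

(* The members of a cover are required to be bounded because the library's diameter
   is an unspecified real number for unbounded sets. *)
definition covering_number :: "'a::euclidean_space set \<Rightarrow> real \<Rightarrow> nat" where
  "covering_number E r =
     (LEAST n. \<exists>C. finite C \<and> card C = n \<and> E \<subseteq> \<Union>C \<and>
                   (\<forall>U\<in>C. bounded U \<and> diameter U \<le> r))"

(* Intended for bounded nonempty E, for which covering_number E r >= 1. *)
definition upper_box_dim :: "'a::euclidean_space set \<Rightarrow> ereal" where
  "upper_box_dim E =
     Limsup (at_right 0) (\<lambda>r. ereal (ln (real (covering_number E r)) / ln (1 / r)))"

end

(* Comparing the phases termwise, |W(x) - W(y)| is at most a constant times the sum of
   a^k min(1, b^k h) with h = |x - y|. Cutting this sum where b^k h crosses 1 leaves two geometric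
   pieces, both of order a^n with b^-n about h, that is of order h^(-log_b a).
   Taking the modulus, real or imaginary part is 1-Lipschitz and preserves this.
   The graph of a Hoelder function of exponent e meets each of the O(1/r) columns of width r/2
   in a set of height O(r^e), hence is covered by O(r^(e-2)) boxes of diameter r. *)
theory Submission
  imports Defs
begin

section \<open>Geometric series with terms cut off by a minimum\<close>

lemma summable_geometric_min:
  fixes a b h :: real
  assumes "0 < a" "a < 1" "0 \<le> b" "0 \<le> h"
  shows "summable (\<lambda>k. a ^ k * min 1 (b ^ k * h))"
proof (rule summable_comparison_test')
  show "summable (\<lambda>k. a ^ k)"
    using assms by (simp add: summable_geometric)
  show "norm (a ^ k * min 1 (b ^ k * h)) \<le> a ^ k" if "k \<ge> 0" for k
    using assms by (simp add: abs_mult mult_left_le min_def)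
qed

text \<open>The first summand of the constant comes from the head, which is a multiple of its last
  term because a b > 1; the second comes from the tail. The exponent \<open>?e\<close> is chosen so
  that \<open>b powr (- ?e) = a\<close>.\<close>

lemma suminf_geometric_min_le:
  fixes a b h :: real
  assumes a: "0 < a" "a < 1" and b: "a * b > 1" and h: "0 < h"
  shows "(\<Sum>k. a ^ k * min 1 (b ^ k * h)) \<le> (b / (a * b - 1) + 1 / (1 - a)) * h powr (- log b a)"
proof -
  have b1: "b > 1"
    using a b by (smt (verit) mult_left_le)
  let ?g = "\<lambda>k. a ^ k * min 1 (b ^ k * h)"
  let ?e = "- log b a"
  have summ: "summable ?g"
    using a b1 h by (intro summable_geometric_min) auto
  have e: "?e > 0"
    using a b1 by simp
  have bpe: "b powr (- ?e) = a"
    using a b1 by simp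
  \<comment> \<open>The minimum is replaced by 1. The instance \<open>m = 0\<close> settles h > 1,
    and \<open>m = n + 1\<close> is the tail after the cut.\<close>
  have geo: "suminf (\<lambda>k. ?g (k + m)) \<le> a ^ m / (1 - a)" for m
  proof -
    have "suminf (\<lambda>k. ?g (k + m)) \<le> (\<Sum>k. a ^ m * a ^ k)"
    proof (rule suminf_le)
      show "?g (k + m) \<le> a ^ m * a ^ k" for k
        using a by (simp add: power_add mult_left_le mult.commute)
      show "summable (\<lambda>k. ?g (k + m))"
        using summ by (rule summable_ignore_initial_segment)
      show "summable (\<lambda>k. a ^ m * a ^ k)"
        using a by (intro summable_mult summable_geometric) simp
    qed
    also have "\<dots> = a ^ m / (1 - a)"
      using a by (subst suminf_mult) (auto simp: summable_geometric suminf_geometric)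
    finally show ?thesis .
  qed
  show ?thesis
  proof (cases "h \<le> 1")
    \<comment> \<open>Already b^0 h exceeds 1, so there is no head; the plain geometric sum suffices
      because h to the power \<open>?e\<close> is at least 1.\<close>
    case False
    have "suminf ?g \<le> 1 / (1 - a)"
      using geo[of 0] by simp
    also have "\<dots> \<le> (b / (a * b - 1) + 1 / (1 - a)) * 1"
      using a b b1 by simp
    also have "\<dots> \<le> (b / (a * b - 1) + 1 / (1 - a)) * h powr ?e"
      using False e a b b1 by (intro mult_left_mono ge_one_powr_ge_zero) auto
    finally show ?thesis .
  next
    case True
    \<comment> \<open>n + 1 is the least exponent at which the power of b exceeds 1 / h. It is not
      0, since h \<le> 1 gives b^0 \<le> 1 / h.\<close>
    obtain n where n: "b ^ n \<le> 1 / h" "1 / h < b ^ (n + 1)"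
    proof -
      obtain m where m: "1 / h < b ^ m"
        using b1 real_arch_pow by blast
      define N where "N = (LEAST m. 1 / h < b ^ m)"
      have N: "1 / h < b ^ N"
        unfolding N_def using m by (rule LeastI)
      have "N \<noteq> 0"
        using N True h by (auto intro!: gr0I simp: divide_simps)
      then obtain n where Nn: "N = Suc n"
        using not0_implies_Suc by blast
      have "\<not> 1 / h < b ^ n"
        using not_less_Least[of n "\<lambda>m. 1 / h < b ^ m"] Nn N_def by simp
      then show thesis
        using that[of n] N Nn by simp
    qed
    \<comment> \<open>Writing a as \<open>b powr (- ?e)\<close> and swapping exponents turns a^(n+1)
      into the power with exponent \<open>?e\<close> of 1 / b^(n+1), which is less than h.\<close>
    have apow: "a ^ (n + 1) \<le> h powr ?e"
    proof -
      have "a ^ (n + 1) = (b powr (- ?e)) powr real (n + 1)"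
        using a bpe powr_realpow[of a "n + 1"] by simp
      also have "\<dots> = (b powr (- real (n + 1))) powr ?e"
        by (simp add: powr_powr algebra_simps)
      also have "b powr (- real (n + 1)) = 1 / b ^ (n + 1)"
        using b1 powr_realpow[of b "n + 1"] by (simp only: powr_minus_divide)
      also have "(1 / b ^ (n + 1)) powr ?e \<le> h powr ?e"
        using n(2) h e b1 by (intro powr_mono2) (auto simp: field_simps intro: less_imp_le)
      finally show ?thesis .
    qed
    have "(\<Sum>k<n+1. ?g k) \<le> (\<Sum>k<n+1. (a * b) ^ k * h)"
      using a by (intro sum_mono) (simp add: power_mult_distrib)
    also have "\<dots> = ((a * b) ^ (n + 1) - 1) / (a * b - 1) * h"
      using b geometric_sum[of "a * b" "n + 1"] by (simp only: flip: sum_distrib_right)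
    also have "\<dots> \<le> (a * b) ^ (n + 1) / (a * b - 1) * h"
      using b h by (intro mult_right_mono divide_right_mono) auto
    \<comment> \<open>One factor b is split off so that the remaining b^n h is at most 1 by the
      choice of n; it survives as the numerator of the constant.\<close>
    also have "\<dots> = (b ^ n * h) * (b / (a * b - 1)) * a ^ (n + 1)"
      by (simp add: power_mult_distrib)
    also have "\<dots> \<le> 1 * (b / (a * b - 1)) * a ^ (n + 1)"
      using n(1) h a b b1 by (intro mult_right_mono) (auto simp: field_simps)
    finally have low: "(\<Sum>k<n+1. ?g k) \<le> b / (a * b - 1) * a ^ (n + 1)"
      by simp
    have "suminf ?g = suminf (\<lambda>k. ?g (k + (n + 1))) + (\<Sum>k<n+1. ?g k)"
      using summ by (rule suminf_split_initial_segment)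
    also have "\<dots> \<le> a ^ (n + 1) / (1 - a) + b / (a * b - 1) * a ^ (n + 1)"
      using low geo by (intro add_mono)
    also have "\<dots> = (b / (a * b - 1) + 1 / (1 - a)) * a ^ (n + 1)"
      by (simp add: algebra_simps)
    also have "\<dots> \<le> (b / (a * b - 1) + 1 / (1 - a)) * h powr ?e"
      using apow a b b1 by (intro mult_left_mono) auto
    finally show ?thesis .
  qed
qed

section \<open>Hoelder continuity of the series\<close>

lemma norm_exp_i_diff_le:
  fixes x y :: real
  shows "cmod (exp (\<i> * of_real x) - exp (\<i> * of_real y)) \<le> min 2 \<bar>x - y\<bar>"
proof -
  \<comment> \<open>Factoring out a number of modulus 1 leaves a chord of the unit circle, of length
    2 |sin ((x - y) / 2)|. Bounding the sine by 1 or by its argument gives the two sides of the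
    minimum.\<close>
  have "exp (\<i> * of_real x) - exp (\<i> * of_real y) =
      exp (\<i> * of_real y) * (exp (\<i> * of_real (x - y)) - 1)"
    by (simp add: algebra_simps exp_diff)
  then have "cmod (exp (\<i> * of_real x) - exp (\<i> * of_real y)) = 2 * \<bar>sin ((x - y) / 2)\<bar>"
    by (simp only: norm_mult norm_exp_i_times dist_exp_i_1)
  then show ?thesis
    using abs_sin_x_le_abs_x[of "(x - y) / 2"] abs_sin_le_one[of "(x - y) / 2"] by simp
qed

text \<open>The phases of the term with exponent k differ by 2 pi b^k h, so that term changes by at
  most M a^k min(2, 2 pi b^k h). This is where M and 2 pi enter;
  \<open>suminf_geometric_min_le\<close> supplies the rest.\<close>

lemma W_holder_bound:
  fixes a :: real and b :: int
  assumes a: "0 < a" "a < 1" and b: "a * of_int b > 1" and f: "\<And>k. k \<ge> 1 \<Longrightarrow> cmod (f k) \<le> M"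
  shows "cmod (W a b f x - W a b f y) \<le>
    M * (2 * pi) * (b / (a * b - 1) + 1 / (1 - a)) * \<bar>x - y\<bar> powr (- log b a)"
proof (cases "x = y")
  \<comment> \<open>Separated because the series estimate needs h > 0.\<close>
  case True
  then show ?thesis by simp
next
  case False
  define h where "h = \<bar>x - y\<bar>"
  have h: "h > 0"
    using False by (simp add: h_def)
  have M: "M \<ge> 0"
    using f[of 1] norm_ge_zero[of "f 1"] by linarith
  have b0: "of_int b > (0::real)"
    using a b by (smt (verit) mult_nonneg_nonpos)
  define F where "F t k = f (Suc k) * of_real a ^ Suc k *
           exp (2 * of_real pi * \<i> * of_int b ^ Suc k * of_real t)" for t :: real and k
  define g where "g k = a ^ k * min 1 (real_of_int b ^ k * h)" for k
  have expeq: "exp (2 * of_real pi * \<i> * of_int b ^ k * of_real t)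
      = exp (\<i> * of_real (2 * pi * b ^ k * t))" for k and t :: real
    by (simp add: mult_ac)
  have "norm (F t k) \<le> M * a * a ^ k" for t k
  proof -
    have "norm (F t k) = cmod (f (Suc k)) * a ^ Suc k"
      unfolding F_def expeq norm_mult norm_exp_i_times norm_power norm_of_real using a by simp
    also have "\<dots> \<le> M * a ^ Suc k"
      using f[of "Suc k"] a by (intro mult_right_mono) auto
    finally show ?thesis by simp
  qed
  then have sF: "summable (F t)" for t
    by (rule summable_comparison_test'[rotated]) (use a in \<open>auto intro!: summable_mult summable_geometric\<close>)
  have sg: "summable g"
    unfolding g_def using a b0 h by (intro summable_geometric_min) auto
  have diff: "norm (F x k - F y k) \<le> M * (2 * pi) * g (Suc k)" for k
  proof -
    let ?z = "exp (\<i> * of_real (2 * pi * b ^ Suc k * x)) - exp (\<i> * of_real (2 * pi * b ^ Suc k * y))"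
    have "cmod ?z \<le> min 2 \<bar>2 * pi * b ^ Suc k * x - 2 * pi * b ^ Suc k * y\<bar>"
      by (rule norm_exp_i_diff_le)
    also have "2 * pi * b ^ Suc k * x - 2 * pi * b ^ Suc k * y = 2 * pi * b ^ Suc k * (x - y)"
      by (simp add: right_diff_distrib)
    also have "\<bar>\<dots>\<bar> = 2 * pi * (b ^ Suc k * h)"
      using b0 by (simp add: abs_mult h_def)
    \<comment> \<open>Since 2 \<le> 2 pi, the factor 2 pi can be pulled out of both sides of the
      minimum.\<close>
    also have "min 2 (2 * pi * (b ^ Suc k * h)) \<le> 2 * pi * min 1 (b ^ Suc k * h)"
      using pi_ge_two by (cases "b ^ Suc k * h \<le> 1") (simp_all only: min.absorb2 min_le_iff_disj, auto)
    finally have z: "cmod ?z \<le> 2 * pi * min 1 (b ^ Suc k * h)" .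
    have "F x k - F y k = f (Suc k) * of_real a ^ Suc k * ?z"
      unfolding F_def expeq by (simp only: right_diff_distrib)
    then have "norm (F x k - F y k) = cmod (f (Suc k)) * a ^ Suc k * cmod ?z"
      using a by (simp only: norm_mult norm_power norm_of_real abs_of_pos)
    also have "\<dots> \<le> M * a ^ Suc k * (2 * pi * min 1 (b ^ Suc k * h))"
      using f[of "Suc k"] a M z by (intro mult_mono) auto
    finally show ?thesis
      by (simp add: g_def mult_ac)
  qed
  have sg': "summable (\<lambda>k. g (Suc k))"
    using sg by (simp add: summable_Suc_iff)
  have "W a b f x - W a b f y = (\<Sum>k. F x k - F y k)"
    unfolding W_def F_def[symmetric] using sF by (rule suminf_diff) (rule sF)
  also have "cmod \<dots> \<le> (\<Sum>k. M * (2 * pi) * g (Suc k))"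
    using diff sg' by (intro norm_suminf_le summable_mult)
  also have "\<dots> = M * (2 * pi) * (\<Sum>k. g (Suc k))"
    using sg' by (rule suminf_mult)
  \<comment> \<open>The series for \<open>W\<close> starts at exponent 1; adding the nonnegative
    term with exponent 0 completes the sum.\<close>
  also have "\<dots> \<le> M * (2 * pi) * suminf g"
    using suminf_split_head[OF sg] M h by (intro mult_left_mono) (auto simp: g_def)
  also have "\<dots> \<le> M * (2 * pi) * ((b / (a * b - 1) + 1 / (1 - a)) * h powr (- log b a))"
    unfolding g_def using suminf_geometric_min_le[OF a b h] M by (intro mult_left_mono) auto
  finally show ?thesis
    by (simp add: h_def mult.assoc)
qed

lemma holder_continuous_W:
  fixes a :: real and b :: int
  assumes a: "0 < a" "a < 1" and b: "real_of_int b > 1 / a" and f: "bounded (f ` {1..})"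
  shows "holder_continuous (- log b a) (W a b f)"
proof -
  have ab: "a * b > 1"
    using a b by (simp add: field_simps)
  have b1: "real_of_int b > 1"
    using a b by (smt (verit) less_divide_eq_1_pos)
  obtain M where M: "M > 0" "\<And>k. k \<ge> 1 \<Longrightarrow> cmod (f k) \<le> M"
    using f by (auto simp: bounded_pos)
  \<comment> \<open>The hypothesis b > 1 / a says that b^(-1) < a, which is exactly that the Hoelder
    exponent is below 1.\<close>
  have "- 1 < log b a"
    using a b b1 by (subst less_log_iff) (auto simp: powr_minus_divide field_simps)
  moreover have "log b a < 0"
    using a b1 by simp
  moreover have "M * (2 * pi) * (b / (a * b - 1) + 1 / (1 - a)) > 0"
    using M a ab b1 by (intro mult_pos_pos add_pos_pos) auto
  ultimately show ?thesis
    unfolding holder_continuous_def using W_holder_bound[OF a ab M(2)] by fastforce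
qed

lemma holder_continuous_Lipschitz_compose:
  assumes "holder_continuous \<eta> g" and "\<And>u v. norm (p u - p v) \<le> norm (u - v)"
  shows "holder_continuous \<eta> (\<lambda>t. p (g t))"
  using assms unfolding holder_continuous_def by (meson order_trans)

section \<open>Covering numbers and box dimension of graphs\<close>

lemma covering_number_le_card:
  assumes "finite C" "E \<subseteq> \<Union>C" "\<And>U. U \<in> C \<Longrightarrow> bounded U" "\<And>U. U \<in> C \<Longrightarrow> diameter U \<le> r"
  shows "covering_number E r \<le> card C"
  unfolding covering_number_def by (rule Least_le) (use assms in blast)

text \<open>The norm of a pair is at most the sum of the norms of its components. This crude bound
  is what lets grid cells of side r / 2 serve as sets of diameter at most r.\<close>

lemma diameter_Times_le:
  fixes A :: "'a::real_normed_vector set" and B :: "'b::real_normed_vector set"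
  assumes "\<And>x y. x \<in> A \<Longrightarrow> y \<in> A \<Longrightarrow> norm (x - y) \<le> c"
    and "\<And>x y. x \<in> B \<Longrightarrow> y \<in> B \<Longrightarrow> norm (x - y) \<le> d"
    and "0 \<le> c" "0 \<le> d"
  shows "diameter (A \<times> B) \<le> c + d"
proof (rule diameter_le)
  fix p q assume "p \<in> A \<times> B" "q \<in> A \<times> B"
  then obtain x y x' y' where pq: "p = (x, y)" "q = (x', y')" "x \<in> A" "y \<in> B" "x' \<in> A" "y' \<in> B"
    by auto
  have "norm (p - q) \<le> norm (x - x') + norm (y - y')"
    using norm_Pair_le[of "x - x'" "y - y'"] by (simp add: pq)
  also have "\<dots> \<le> c + d"
    using assms pq by (intro add_mono) auto
  finally show "norm (p - q) \<le> c + d" .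
qed (use assms in auto)

text \<open>The index is the floor of x / d, and the strict bound on x keeps it below n. It locates
  both the column and the cell within the column.\<close>

lemma ex_nat_grid_cell:
  fixes x d :: real
  assumes "0 < d" "0 \<le> x" "x < real n * d"
  obtains i where "i < n" "real i * d \<le> x" "x \<le> real (Suc i) * d"
proof
  let ?i = "nat \<lfloor>x / d\<rfloor>"
  have eq: "real ?i = of_int \<lfloor>x / d\<rfloor>"
    using assms by simp
  have "real ?i \<le> x / d" and u: "x / d < real ?i + 1"
    unfolding eq by linarith+
  then have "real ?i * d \<le> x" and "x < (real ?i + 1) * d"
    using assms by (simp_all only: pos_le_divide_eq pos_divide_less_eq)
  then show le: "real ?i * d \<le> x" and "x \<le> real (Suc ?i) * d"
    by (simp_all add: add.commute)
  have "real ?i * d < real n * d"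
    using le assms by linarith
  then have "real ?i < real n"
    using assms by (simp only: mult_less_cancel_right_pos)
  then show "?i < n"
    by (simp only: of_nat_less_iff)
qed

text \<open>The bound is a product of two counts: at most 4 / r columns, and at most
  \<open>(4 * K + 2) * r powr (\<eta> - 1)\<close> cells in each.\<close>

lemma covering_number_graph_le:
  fixes g :: "real \<Rightarrow> real"
  assumes \<eta>: "0 < \<eta>" "\<eta> < 1" and K: "K > 0" "\<And>x y. \<bar>g x - g y\<bar> \<le> K * \<bar>x - y\<bar> powr \<eta>"
    and r: "0 < r" "r < 1"
  shows "real (covering_number (graph_on {0..1} g) r) \<le> (4 * (4 * K + 2)) * r powr (\<eta> - 2)"
proof -
  \<comment> \<open>A cell with both sides d has diameter at most d + d = r. \<open>L\<close> bounds
    the change of g over a distance d.\<close>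
  define d where "d = r / 2"
  define L where "L = K * d powr \<eta>"
  \<comment> \<open>The added 1 makes n d > 1 and m d > 2 L strict, as
    \<open>ex_nat_grid_cell\<close> requires at t = 1 and at the top of a column.\<close>
  define n where "n = nat \<lceil>1 / d\<rceil> + 1"
  define m where "m = nat \<lceil>2 * L / d\<rceil> + 1"
  \<comment> \<open>Each stack of cells starts L below the value of g at the left edge of its
    column, so a height of 2 L reaches every value of g over that column.\<close>
  define U where "U = (\<lambda>(i, j). {real i * d .. real (Suc i) * d} \<times>
    {g (real i * d) - L + real j * d .. g (real i * d) - L + real (Suc j) * d})"
  let ?C = "U ` ({..<n} \<times> {..<m})"
  have d: "0 < d"
    using r by (simp add: d_def)
  have L: "0 < L"
    using K d by (simp add: L_def)
  have n1: "1 < real n * d"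
  proof -
    have "1 / d < real n"
      unfolding n_def by linarith
    then show ?thesis using d by (simp add: field_simps)
  qed
  have m1: "2 * L < real m * d"
  proof -
    have "2 * L / d < real m"
      unfolding m_def by linarith
    then show ?thesis using d by (simp add: field_simps)
  qed
  have "covering_number (graph_on {0..1} g) r \<le> card ?C"
  proof (rule covering_number_le_card)
    show "finite ?C" by simp
    show "graph_on {0..1} g \<subseteq> \<Union>?C"
    proof
      fix p assume "p \<in> graph_on {0..1} g"
      then obtain t where t: "0 \<le> t" "t \<le> 1" "p = (t, g t)"
        by (auto simp: graph_on_def)
      obtain i where i: "i < n" "real i * d \<le> t" "t \<le> real (Suc i) * d"
        using ex_nat_grid_cell[of d t n] d t n1 by auto
      have "\<bar>t - real i * d\<bar> \<le> d"
        using i by (simp add: algebra_simps)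
      then have "K * \<bar>t - real i * d\<bar> powr \<eta> \<le> L"
        unfolding L_def using K \<eta> by (intro mult_left_mono powr_mono2) auto
      then have "\<bar>g t - g (real i * d)\<bar> \<le> L"
        using K(2)[of t "real i * d"] by linarith
      then have "0 \<le> g t - (g (real i * d) - L)" "g t - (g (real i * d) - L) < real m * d"
        using m1 by linarith+
      then obtain j where "j < m" "real j * d \<le> g t - (g (real i * d) - L)"
        "g t - (g (real i * d) - L) \<le> real (Suc j) * d"
        using ex_nat_grid_cell[of d] d by blast
      with i t have "p \<in> U (i, j)"
        unfolding U_def prod.case t(3) mem_Times_iff fst_conv snd_conv atLeastAtMost_iff by linarith
      with i \<open>j < m\<close> show "p \<in> \<Union>?C"
        by blast
    qed
    show "bounded V" if "V \<in> ?C" for V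
      using that by (auto simp: U_def intro!: bounded_Times)
    show "diameter V \<le> r" if V_in: "V \<in> ?C" for V
    proof -
      obtain i j where V: "V = U (i, j)"
        using V_in by blast
      have "diameter V \<le> d + d"
        unfolding V U_def prod.case using d
        by (intro diameter_Times_le) (auto simp: algebra_simps)
      then show ?thesis by (simp add: d_def)
    qed
  qed
  also have "card ?C \<le> n * m"
    using card_image_le[of "{..<n} \<times> {..<m}" U] by (simp add: card_cartesian_product)
  finally have "real (covering_number (graph_on {0..1} g) r) \<le> real n * real m"
    by (metis of_nat_le_iff of_nat_mult)
  also have "\<dots> \<le> (4 / r) * ((4 * K + 2) * r powr (\<eta> - 1))"
  proof (rule mult_mono)
    have "1 / d > 0" using d by simp
    \<comment> \<open>One unit pays for the ceiling and one for the added 1; then 2 / r + 2 \<le> 4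
      / r because r < 1.\<close>
    then have "real n \<le> 1 / d + 2"
      unfolding n_def by linarith
    also have "\<dots> \<le> 4 / r"
      using r by (simp add: d_def field_simps)
    finally show "real n \<le> 4 / r" .
    have "2 * L / d > 0" using d L by simp
    then have "real m \<le> 2 * L / d + 2"
      unfolding m_def by linarith
    \<comment> \<open>In \<open>L\<close> the width d is enlarged to r, while the denominator is r /
      2; hence the factor 4.\<close>
    also have "2 * L / d \<le> 4 * K * r powr (\<eta> - 1)"
    proof -
      have "L \<le> K * r powr \<eta>"
        unfolding L_def using K \<eta> r by (intro mult_left_mono powr_mono2) (auto simp: d_def)
      then have "2 * L / d \<le> 4 * (K * r powr \<eta>) / r"
        using r by (simp add: d_def field_simps)
      then show ?thesis
        using r by (simp add: powr_diff)
    qed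
    \<comment> \<open>The additive 2 is absorbed because a negative power of r < 1 is at least
      1.\<close>
    also have "(2::real) \<le> 2 * r powr (\<eta> - 1)"
      using powr_mono2'[of "1 - \<eta>" r 1] powr_mono'[of "\<eta> - 1" 0 r] r \<eta> by simp
    finally show "real m \<le> (4 * K + 2) * r powr (\<eta> - 1)"
      by (simp add: algebra_simps)
  qed (use r in auto)
  also have "\<dots> = (4 * (4 * K + 2)) * r powr (\<eta> - 2)"
  proof -
    have "r powr (\<eta> - 2) = r powr (\<eta> - 1) / r"
      using r powr_diff[of r "\<eta> - 1" 1] by simp
    then show ?thesis by (simp only: times_divide_eq_left times_divide_eq_right mult_ac)
  qed
  finally show ?thesis .
qed

text \<open>After taking logarithms, the factor D contributes only ln D / ln (1 / r), which vanishes
  as r tends to 0.\<close>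

lemma upper_box_dim_le:
  assumes D: "D \<ge> 1" and s: "s \<ge> 0"
    and cov: "\<And>r. 0 < r \<Longrightarrow> r < 1 \<Longrightarrow> real (covering_number E r) \<le> D * r powr (- s)"
  shows "upper_box_dim E \<le> ereal s"
proof -
  let ?v = "\<lambda>r::real. ln D / ln (1 / r) + s"
  have "ln (real (covering_number E r)) / ln (1 / r) \<le> ?v r" if r: "0 < r" "r < 1" for r
  proof -
    have pos: "ln (1 / r) > 0"
      using r by simp
    have "ln (real (covering_number E r)) \<le> ln D + s * ln (1 / r)"
    proof (cases "covering_number E r = 0")
      \<comment> \<open>Here the convention \<open>ln 0 = 0\<close> applies, so the right side has
        to be nonnegative: this uses D \<ge> 1 and s \<ge> 0.\<close>
      case True
      then show ?thesis using D s pos by simp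
    next
      case False
      then have "ln (real (covering_number E r)) \<le> ln (D * r powr (- s))"
        using cov[OF r] by (intro ln_mono) auto
      also have "\<dots> = ln D + s * ln (1 / r)"
        using D r by (simp add: ln_mult ln_div)
      finally show ?thesis .
    qed
    then show ?thesis
      using pos by (simp add: field_simps)
  qed
  then have "\<forall>\<^sub>F r in at_right 0. ereal (ln (real (covering_number E r)) / ln (1 / r)) \<le> ereal (?v r)"
    unfolding eventually_at_right_field by (auto intro!: exI[of _ 1])
  then have "upper_box_dim E \<le> Limsup (at_right 0) (\<lambda>r. ereal (?v r))"
    unfolding upper_box_dim_def by (rule Limsup_mono)
  also have "\<dots> = ereal s"
  proof (rule lim_imp_Limsup)
    have "filterlim (\<lambda>r::real. ln (1 / r)) at_top (at_right 0)"
      using filterlim_compose[OF ln_at_top filterlim_inverse_at_top_right]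
      by (simp add: inverse_eq_divide)
    then have "((\<lambda>r. ln D / ln (1 / r)) \<longlongrightarrow> 0) (at_right 0)"
      by (intro tendsto_divide_0[OF tendsto_const] filterlim_at_top_imp_at_infinity)
    then have "(?v \<longlongrightarrow> 0 + s) (at_right 0)"
      by (intro tendsto_add tendsto_const)
    then show "((\<lambda>r. ereal (?v r)) \<longlongrightarrow> ereal s) (at_right 0)"
      by simp
  qed simp
  finally show ?thesis .
qed

lemma upper_box_dim_graph_holder:
  fixes g :: "real \<Rightarrow> real"
  assumes "holder_continuous \<eta> g"
  shows "upper_box_dim (graph_on {0..1} g) \<le> ereal (2 - \<eta>)"
proof -
  obtain K where \<eta>: "0 < \<eta>" "\<eta> < 1" and K: "K > 0" "\<And>x y. \<bar>g x - g y\<bar> \<le> K * \<bar>x - y\<bar> powr \<eta>"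
    using assms by (auto simp: holder_continuous_def)
  show ?thesis
    using covering_number_graph_le[OF \<eta> K] \<eta> K
    by (intro upper_box_dim_le[where D = "4 * (4 * K + 2)"]) auto
qed

theorem corollary5p1:
  fixes a :: real and b :: int and f :: "nat \<Rightarrow> complex"
  assumes "0 < a" and "a < 1"
    and "real_of_int b > 1 / a"
    and "bounded (f ` {1..})"
  shows "(holder_continuous (- log (real_of_int b) a) (\<lambda>t. W a b f t) \<and>
          holder_continuous (- log (real_of_int b) a) (\<lambda>t. cmod (W a b f t)) \<and>
          holder_continuous (- log (real_of_int b) a) (\<lambda>t. Re (W a b f t)) \<and>
          holder_continuous (- log (real_of_int b) a) (\<lambda>t. Im (W a b f t))) \<and>
         (upper_box_dim (graph_on {0..1} (\<lambda>t. cmod (W a b f t))) \<le> ereal (2 + log (real_of_int b) a) \<and>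
          upper_box_dim (graph_on {0..1} (\<lambda>t. Re (W a b f t))) \<le> ereal (2 + log (real_of_int b) a) \<and>
          upper_box_dim (graph_on {0..1} (\<lambda>t. Im (W a b f t))) \<le> ereal (2 + log (real_of_int b) a))"
proof -
  let ?\<eta> = "- log (real_of_int b) a"
  have W: "holder_continuous ?\<eta> (\<lambda>t. W a b f t)"
    using holder_continuous_W[OF assms] by simp
  \<comment> \<open>The modulus is 1-Lipschitz by the reverse triangle inequality; the real and
    imaginary parts are so because they are additive and bounded by the modulus.\<close>
  have cmod: "holder_continuous ?\<eta> (\<lambda>t. cmod (W a b f t))"
    by (rule holder_continuous_Lipschitz_compose[OF W]) (simp add: norm_triangle_ineq3)
  have Re: "holder_continuous ?\<eta> (\<lambda>t. Re (W a b f t))"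
    by (rule holder_continuous_Lipschitz_compose[OF W]) (simp add: abs_Re_le_cmod flip: minus_complex.sel)
  have Im: "holder_continuous ?\<eta> (\<lambda>t. Im (W a b f t))"
    by (rule holder_continuous_Lipschitz_compose[OF W]) (simp add: abs_Im_le_cmod flip: minus_complex.sel)
  show ?thesis
    using W cmod Re Im upper_box_dim_graph_holder[OF cmod] upper_box_dim_graph_holder[OF Re]
      upper_box_dim_graph_holder[OF Im] by simp
qed

end
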